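(* Let $Y$ be a linear subspace of $\mathbb C^2$, $K$ a complex $2\times2$-matrix, and $u_0\in H_Y$. Let $u(t,\cdot)=e^{-tA_{Y,K}}u_0$ be the unique solution of the heat equation $\frac{\partial u}{\partial t}=\frac{\partial^2u}{\partial x^2}$ ($t>0$, $x\in(0,1)$) with $u(0,\cdot)=u_0$ and the conditions $\Gamma_1u(t)\in Y$ and $K\Gamma_1 u(t)+\begin{pmatrix}\mu_0(u''(t))+u(t,1)\\ u(t,0)-u(t,1)\end{pmatrix}\in Y^\perp$ for $t>0$. Then for all $t>0$ one has $u(t,\cdot)\in C^\infty([0,1])$, and, writing $u^{(j)}$ for the $j$-th derivative with respect to $x$, $u$ and its derivatives fulfill, for all $t>0$ and all integers $h\ge1$, the non-local boundary conditions $$\begin{pmatrix}u^{(2h-1)}(t,1)-u^{(2h-1)}(t,0)\\ u^{(2h-2)}(t,1)-u^{(2h-2)}(t,0)-u^{(2h-1)}(t,0)\end{pmatrix}\in Y$$ and $$K\begin{pmatrix}u^{(2h-1)}(t,1)-u^{(2h-1)}(t,0)\\ u^{(2h-2)}(t,1)-u^{(2h-2)}(t,0)-u^{(2h-1)}(t,0)\end{pmatrix}+\begin{pmatrix}u^{(2h+1)}(t,1)-u^{(2h+1)}(t,0)+u^{(2h)}(t,1)\\ u^{(2h)}(t,0)-u^{(2h)}(t,1)\end{pmatrix}\in Y^\perp .$$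
   Context: All spaces are complex; inner products are linear in the first argument. $H^1(T):=\{u\in H^1(0,1):u(0)=u(1)\}$, $H^{-1}(T)$ is its dual, with $f\in L^2(0,1)$ identified with $\varphi\mapsto\int_0^1 f\varphi\,dx$. Put $\mu_0(\varphi):=\langle\varphi,1\rangle$ for $\varphi\in H^{-1}(T)$ and $\mu_1(f):=\int_0^1(1-x)f(x)\,dx$ for $f\in L^2(0,1)$; $\Gamma_1 f:=(\mu_0(f),\mu_1(f))^\top$. The operator $P:H^{-1}(T)\to L^2(0,1)$ (bounded) is defined by $\langle Pu,\varphi\rangle=\langle u,J\varphi\rangle$, $J\varphi(x):=\int_x^1\big(\varphi(y)-\int_0^1\varphi(z)dz\big)dy$. $H^{-1}(T)$ is equipped with the (equivalent) inner product $(f|g)_{H^{-1}(T)}:=(Pf|Pg)_{L^2}+\mu_0(f)\overline{\mu_0(g)}$. $H:=\{w\in H^{-1}(T):\mu_0(w)=0\}$ with the restricted inner product. For a subspace $Y$ of $\mathbb C^2$: $V_Y:=\{f\in L^2(0,1):\Gamma_1 f\in Y\}$ with the $L^2$ inner product; $H_Y:=H$ if $Y=\{0\}^2$ or $Y=\{0\}\times\mathbb C$, and $H_Y:=H^{-1}(T)$ otherwise ($V_Y$ is dense in $H_Y$). For a complex $2\times2$-matrix $K$, $a_K(f,g):=(f|g)_{L^2}+(K\Gamma_1 f|\Gamma_1 g)_{\mathbb C^2}$, $f,g\in V_Y$. The associated operator is: $D(A_{Y,K}):=\{f\in V_Y:\exists g\in H_Y,\ a_K(f,h)=(g|h)_{H^{-1}(T)}\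 \forall h\in V_Y\}$, $A_{Y,K}f:=g$; $-A_{Y,K}$ generates an analytic semigroup $(e^{-tA_{Y,K}})_{t\ge0}$ on $H_Y$. *)

theory Defs
  imports "HOL-Analysis.Analysis"
begin

section \<open>Function spaces on the unit interval\<close>

text \<open>
  Elements of \<open>L\<^sup>2(0,1)\<close> are represented by functions \<open>real \<Rightarrow> complex\<close>. No quotient is taken:
  everything below depends on such a function only up to null sets of \<open>(0,1)\<close>.
\<close>

abbreviation M01 :: "real measure" where
  "M01 \<equiv> lebesgue_on {0<..<1}"

definition L2 :: "(real \<Rightarrow> complex) set" where
  "L2 = {f. f \<in> borel_measurable M01 \<and> integrable M01 (\<lambda>x. (cmod (f x))\<^sup>2)}"

definition inner_L2 :: "(real \<Rightarrow> complex) \<Rightarrow> (real \<Rightarrow> complex) \<Rightarrow> complex" where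
  "inner_L2 f g = (\<integral>x. f x * cnj (g x) \<partial>M01)"

text \<open>
  \<open>H\<^sup>1(0,1)\<close> is described by the continuous representatives on \<open>[0,1]\<close>: \<open>v\<close> is the (weak) derivative
  of \<open>u\<close> iff \<open>v\<close> is square integrable and \<open>u\<close> is a primitive of \<open>v\<close>.
\<close>

definition has_H1_deriv :: "(real \<Rightarrow> complex) \<Rightarrow> (real \<Rightarrow> complex) \<Rightarrow> bool" where
  "has_H1_deriv u v \<longleftrightarrow>
     v \<in> L2 \<and> (\<forall>x\<in>{0..1}. u x = u 0 + (\<integral>y. v y \<partial>lebesgue_on {0<..<x}))"

text \<open>
  The elements of \<open>H\<^sup>1(T)\<close> are functions on \<open>[0,1]\<close>; as HOL functions are total, they are continued
  by \<open>0\<close> outside \<open>[0,1]\<close>, so that equality of functions is equality in \<open>H\<^sup>1(T)\<close>.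
\<close>

definition H1T :: "(real \<Rightarrow> complex) set" where
  "H1T = {u. (\<exists>v. has_H1_deriv u v) \<and> u 0 = u 1 \<and> (\<forall>x. x \<notin> {0..1} \<longrightarrow> u x = 0)}"

text \<open>
  The dual \<open>H\<^sup>-\<^sup>1(T)\<close>: complex-linear functionals on \<open>H\<^sup>1(T)\<close> that are bounded for the norm
  \<open>sqrt (\<parallel>u\<parallel>\<^sup>2 + \<parallel>u'\<parallel>\<^sup>2)\<close> with \<open>L\<^sup>2\<close> norms. They are continued by \<open>0\<close> outside \<open>H\<^sup>1(T)\<close>, which again makes
  HOL equality the right one. The duality pairing \<open>\<langle>F,\<phi>\<rangle>\<close> is application \<open>F \<phi>\<close>.
\<close>

type_synonym functional = "(real \<Rightarrow> complex) \<Rightarrow> complex"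

definition Hm1 :: "functional set" where
  "Hm1 = {F. (\<forall>\<phi>. \<phi> \<notin> H1T \<longrightarrow> F \<phi> = 0)
     \<and> (\<forall>\<phi>\<in>H1T. \<forall>\<psi>\<in>H1T. F (\<lambda>x. \<phi> x + \<psi> x) = F \<phi> + F \<psi>)
     \<and> (\<forall>c. \<forall>\<phi>\<in>H1T. F (\<lambda>x. c * \<phi> x) = c * F \<phi>)
     \<and> (\<exists>C. \<forall>\<phi>\<in>H1T. \<forall>\<phi>'. has_H1_deriv \<phi> \<phi>' \<longrightarrow>
          cmod (F \<phi>) \<le> C * sqrt ((\<integral>x. (cmod (\<phi> x))\<^sup>2 \<partial>M01) + (\<integral>x. (cmod (\<phi>' x))\<^sup>2 \<partial>M01)))}"

text \<open>The identification of \<open>L\<^sup>2(0,1)\<close> with a subspace of \<open>H\<^sup>-\<^sup>1(T)\<close> (bilinear, no conjugation).\<close>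

definition emb :: "(real \<Rightarrow> complex) \<Rightarrow> functional" where
  "emb f = (\<lambda>\<phi>. if \<phi> \<in> H1T then (\<integral>x. f x * \<phi> x \<partial>M01) else 0)"

section \<open>Moments, the operator \<open>P\<close> and the inner product of \<open>H\<^sup>-\<^sup>1(T)\<close>\<close>

text \<open>The indicator of \<open>[0,1]\<close> is the constant function \<open>1\<close> as an element of \<open>H\<^sup>1(T)\<close>.\<close>

definition mu0 :: "functional \<Rightarrow> complex" where
  "mu0 F = F (indicator {0..1})"

definition mu1 :: "(real \<Rightarrow> complex) \<Rightarrow> complex" where
  "mu1 f = (\<integral>x. of_real (1 - x) * f x \<partial>M01)"

definition Gamma1 :: "(real \<Rightarrow> complex) \<Rightarrow> complex ^ 2" where
  "Gamma1 f = vector [mu0 (emb f), mu1 f]"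

definition J_op :: "(real \<Rightarrow> complex) \<Rightarrow> real \<Rightarrow> complex" where
  "J_op \<phi> = (\<lambda>x. if x \<in> {0..1}
       then (\<integral>y. \<phi> y - (\<integral>z. \<phi> z \<partial>M01) \<partial>lebesgue_on {x<..<1}) else 0)"

text \<open>\<open>P_op u\<close> is a representative of the \<open>L\<^sup>2\<close> class \<open>P u\<close>, which is unique up to null sets.\<close>

definition P_op :: "functional \<Rightarrow> real \<Rightarrow> complex" where
  "P_op u = (SOME p. p \<in> L2 \<and> (\<forall>\<phi>\<in>L2. (\<integral>x. p x * \<phi> x \<partial>M01) = u (J_op \<phi>)))"

definition inner_Hm1 :: "functional \<Rightarrow> functional \<Rightarrow> complex" where
  "inner_Hm1 F G = inner_L2 (P_op F) (P_op G) + mu0 F * cnj (mu0 G)"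

definition norm_Hm1 :: "functional \<Rightarrow> real" where
  "norm_Hm1 F = sqrt (Re (inner_Hm1 F F))"

section \<open>The form and the operator associated with \<open>Y\<close> and \<open>K\<close>\<close>

text \<open>The library inner product on \<open>complex ^ 2\<close> is the real one, hence a separate definition.\<close>

definition inner_C2 :: "complex ^ 2 \<Rightarrow> complex ^ 2 \<Rightarrow> complex" where
  "inner_C2 a b = (\<Sum>i\<in>UNIV. a $ i * cnj (b $ i))"

definition orth_C2 :: "(complex ^ 2) set \<Rightarrow> (complex ^ 2) set" where
  "orth_C2 Y = {a. \<forall>b\<in>Y. inner_C2 a b = 0}"

definition V_sp :: "(complex ^ 2) set \<Rightarrow> (real \<Rightarrow> complex) set" where
  "V_sp Y = {f \<in> L2. Gamma1 f \<in> Y}"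

definition H_sp :: "(complex ^ 2) set \<Rightarrow> functional set" where
  "H_sp Y = (if Y = {0} \<or> Y = {z. z $ 1 = 0} then {w \<in> Hm1. mu0 w = 0} else Hm1)"

definition a_form :: "complex ^ 2 ^ 2 \<Rightarrow> (real \<Rightarrow> complex) \<Rightarrow> (real \<Rightarrow> complex) \<Rightarrow> complex" where
  "a_form K f g = inner_L2 f g + inner_C2 (K *v Gamma1 f) (Gamma1 g)"

text \<open>The operator \<open>A\<close>, given by its graph in \<open>H\<^sub>Y \<times> H\<^sub>Y\<close>.\<close>

definition A_graph :: "(complex ^ 2) set \<Rightarrow> complex ^ 2 ^ 2 \<Rightarrow> (functional \<times> functional) set" where
  "A_graph Y K = {(emb f, g) | f g. f \<in> V_sp Y \<and> g \<in> H_sp Y \<and>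
      (\<forall>h\<in>V_sp Y. a_form K f h = inner_Hm1 g (emb h))}"

section \<open>Analytic semigroups\<close>

text \<open>
  In this section \<open>X\<close> is a space of complex-valued functions on some type with pointwise operations
  (above: a space of functionals), and \<open>N\<close> is its norm.
\<close>

definition sector :: "real \<Rightarrow> complex set" where
  "sector \<theta> = {z. z \<noteq> 0 \<and> \<bar>Arg z\<bar> < \<theta>}"

definition bounded_linear_operator_on ::
    "('a \<Rightarrow> complex) set \<Rightarrow> (('a \<Rightarrow> complex) \<Rightarrow> real) \<Rightarrow>
     (('a \<Rightarrow> complex) \<Rightarrow> ('a \<Rightarrow> complex)) \<Rightarrow> bool" where
  "bounded_linear_operator_on X N B \<longleftrightarrow>
     (\<forall>x\<in>X. B x \<in> X)
     \<and> (\<forall>x\<in>X. \<forall>y\<in>X. B (\<lambda>s. x s + y s) = (\<lambda>s. B x s + B y s))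
     \<and> (\<forall>c. \<forall>x\<in>X. B (\<lambda>s. c * x s) = (\<lambda>s. c * B x s))
     \<and> (\<exists>C. \<forall>x\<in>X. N (B x) \<le> C * N x)"

text \<open>
  A holomorphic family \<open>S\<close> on the sector of half-angle \<open>\<theta>\<close>, with \<open>S 0 = I\<close>. Holomorphy is
  required in the strong sense, which is equivalent to holomorphy in operator norm.
\<close>

definition holomorphic_semigroup ::
    "real \<Rightarrow> ('a \<Rightarrow> complex) set \<Rightarrow> (('a \<Rightarrow> complex) \<Rightarrow> real) \<Rightarrow>
     (complex \<Rightarrow> ('a \<Rightarrow> complex) \<Rightarrow> ('a \<Rightarrow> complex)) \<Rightarrow> bool" where
  "holomorphic_semigroup \<theta> X N S \<longleftrightarrow>
     (\<forall>z\<in>sector \<theta>. bounded_linear_operator_on X N (S z))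
     \<and> (\<forall>x\<in>X. S 0 x = x)
     \<and> (\<forall>z\<in>sector \<theta>. \<forall>w\<in>sector \<theta>. z + w \<in> sector \<theta> \<longrightarrow> (\<forall>x\<in>X. S (z + w) x = S z (S w x)))
     \<and> (\<forall>x\<in>X. \<forall>z\<in>sector \<theta>. \<exists>y\<in>X.
          ((\<lambda>w. N (\<lambda>s. (S w x s - S z x s) / (w - z) - y s)) \<longlongrightarrow> 0) (at z))
     \<and> (\<forall>\<theta>'\<in>{0<..<\<theta>}. \<forall>x\<in>X.
          ((\<lambda>z. N (\<lambda>s. S z x s - x s)) \<longlongrightarrow> 0) (at 0 within sector \<theta>'))"

definition analytic_semigroup ::
    "('a \<Rightarrow> complex) set \<Rightarrow> (('a \<Rightarrow> complex) \<Rightarrow> real) \<Rightarrow>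
     (real \<Rightarrow> ('a \<Rightarrow> complex) \<Rightarrow> ('a \<Rightarrow> complex)) \<Rightarrow> bool" where
  "analytic_semigroup X N T \<longleftrightarrow>
     (\<exists>\<theta> S. 0 < \<theta> \<and> \<theta> \<le> pi / 2 \<and> holomorphic_semigroup \<theta> X N S
        \<and> (\<forall>t\<ge>0. \<forall>x\<in>X. T t x = S (of_real t) x))"

definition generator_graph ::
    "('a \<Rightarrow> complex) set \<Rightarrow> (('a \<Rightarrow> complex) \<Rightarrow> real) \<Rightarrow>
     (real \<Rightarrow> ('a \<Rightarrow> complex) \<Rightarrow> ('a \<Rightarrow> complex)) \<Rightarrow>
     (('a \<Rightarrow> complex) \<times> ('a \<Rightarrow> complex)) set" where
  "generator_graph X N T = {(x, y). x \<in> X \<and> y \<in> X \<and>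
     ((\<lambda>t. N (\<lambda>s. (T t x s - x s) / of_real t - y s)) \<longlongrightarrow> 0) (at_right 0)}"

text \<open>
  \<open>T\<close> is the analytic semigroup \<open>t \<mapsto> e\<^sup>-\<^sup>t\<^sup>A\<close> generated by \<open>-A\<close>, where \<open>A\<close> is given by its graph.
\<close>

definition analytic_semigroup_of_neg ::
    "('a \<Rightarrow> complex) set \<Rightarrow> (('a \<Rightarrow> complex) \<Rightarrow> real) \<Rightarrow>
     (('a \<Rightarrow> complex) \<times> ('a \<Rightarrow> complex)) set \<Rightarrow>
     (real \<Rightarrow> ('a \<Rightarrow> complex) \<Rightarrow> ('a \<Rightarrow> complex)) \<Rightarrow> bool" where
  "analytic_semigroup_of_neg X N A T \<longleftrightarrow>
     analytic_semigroup X N T \<and>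
     generator_graph X N T = {(x, \<lambda>s. - y s) | x y. (x, y) \<in> A}"

section \<open>Smooth functions on \<open>[0,1]\<close>\<close>

text \<open>Derivatives on \<open>[0,1]\<close>, one-sided at the end points; only values in \<open>[0,1]\<close> are meaningful.\<close>

definition nderiv01 :: "nat \<Rightarrow> (real \<Rightarrow> complex) \<Rightarrow> real \<Rightarrow> complex" where
  "nderiv01 n f = ((\<lambda>g x. vector_derivative g (at x within {0..1})) ^^ n) f"

definition smooth01 :: "(real \<Rightarrow> complex) \<Rightarrow> bool" where
  "smooth01 f \<longleftrightarrow> (\<forall>n. \<forall>x\<in>{0..1}. nderiv01 n f differentiable (at x within {0..1}))"

end

theory Submission
  imports Defs
begin

text \<open>
  Since the semigroup is analytic, \<open>u t\<close> lies in the domain of every power of \<open>A\<close>, so there are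
  \<open>f\<^sub>0, f\<^sub>1, \<dots>\<close> in \<open>V_sp Y\<close> with \<open>u t = emb f\<^sub>0\<close> and \<open>A (emb f\<^sub>n) = - emb f\<^sub>n\<^sub>+\<^sub>1\<close>. On \<open>L\<^sup>2\<close> the operator \<open>P\<close>
  is integration, normalised to mean value zero. Testing the form against the kernel of \<open>Gamma1\<close>
  therefore determines \<open>f\<^sub>n\<close> up to an affine function as a double primitive of \<open>f\<^sub>n\<^sub>+\<^sub>1\<close>, and testing
  against affine functions yields the boundary condition involving \<open>K\<close>. Hence \<open>f\<^sub>n'' = f\<^sub>n\<^sub>+\<^sub>1\<close>, so that
  \<open>f\<^sub>0\<close> is smooth with derivatives \<open>f\<^sub>n\<close> of order \<open>2n\<close>; the first vector in the theorem is
  \<open>Gamma1 f\<^sub>h\<close>, computed by partial integration.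
\<close>

section \<open>Square integrable functions on the unit interval\<close>

lemma finite_measure_M01: "finite_measure M01"
  by (rule finite_measure_lebesgue_on) auto

lemma measure_M01 [simp]: "measure M01 {0<..<1} = 1"
  by (simp add: space_restrict_space measure_restrict_space)

lemma L2_measurable: "f \<in> L2 \<Longrightarrow> f \<in> borel_measurable M01"
  by (simp add: L2_def)

lemma L2_mult_integrable:
  assumes "f \<in> L2" "g \<in> L2"
  shows "integrable M01 (\<lambda>x. f x * g x)"
proof (rule Bochner_Integration.integrable_bound)
  show "integrable M01 (\<lambda>x. (cmod (f x))\<^sup>2 + (cmod (g x))\<^sup>2)"
    using assms by (auto simp: L2_def)
  show "(\<lambda>x. f x * g x) \<in> borel_measurable M01"
    using assms by (auto simp: L2_def)
  have "a * b \<le> a\<^sup>2 + b\<^sup>2" if "0 \<le> a" "0 \<le> b" for a b :: real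
    using that sum_squares_bound[of a b] mult_nonneg_nonneg[OF that] by linarith
  then show "AE x in M01. norm (f x * g x) \<le> norm ((cmod (f x))\<^sup>2 + (cmod (g x))\<^sup>2)"
    by (simp add: norm_mult)
qed

lemma L2_add:
  assumes "f \<in> L2" "g \<in> L2"
  shows "(\<lambda>x. f x + g x) \<in> L2"
proof -
  have "integrable M01 (\<lambda>x. (cmod (f x + g x))\<^sup>2)"
  proof (rule Bochner_Integration.integrable_bound)
    show "integrable M01 (\<lambda>x. 2 * (cmod (f x))\<^sup>2 + 2 * (cmod (g x))\<^sup>2)"
      using assms by (auto simp: L2_def)
    show "(\<lambda>x. (cmod (f x + g x))\<^sup>2) \<in> borel_measurable M01"
      using assms by (auto simp: L2_def)
    have "(cmod (a + b))\<^sup>2 \<le> 2 * (cmod a)\<^sup>2 + 2 * (cmod b)\<^sup>2" for a b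
    proof -
      have "(cmod (a + b))\<^sup>2 \<le> (cmod a + cmod b)\<^sup>2"
        by (simp add: norm_triangle_ineq power_mono)
      then show ?thesis
        using sum_squares_bound[of "cmod a" "cmod b"] by (simp add: power2_sum)
    qed
    then show "AE x in M01. norm ((cmod (f x + g x))\<^sup>2) \<le> norm (2 * (cmod (f x))\<^sup>2 + 2 * (cmod (g x))\<^sup>2)"
      by simp
  qed
  then show ?thesis
    using assms by (auto simp: L2_def)
qed

lemma L2_cmult: "f \<in> L2 \<Longrightarrow> (\<lambda>x. c * f x) \<in> L2"
  by (auto simp: L2_def norm_mult power_mult_distrib)

lemma L2_diff:
  assumes "f \<in> L2" "g \<in> L2"
  shows "(\<lambda>x. f x - g x) \<in> L2"
  using L2_add[OF assms(1) L2_cmult[OF assms(2), of "-1"]] by simp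

lemma L2_cnj: "f \<in> L2 \<Longrightarrow> (\<lambda>x. cnj (f x)) \<in> L2"
  by (auto simp: L2_def intro: measurable_compose[OF _ borel_measurable_continuous_onI[OF continuous_on_cnj]])

lemma L2_bounded:
  assumes "f \<in> borel_measurable M01" and "\<And>x. x \<in> {0<..<1} \<Longrightarrow> cmod (f x) \<le> C"
  shows "f \<in> L2"
proof -
  interpret finite_measure M01 by (rule finite_measure_M01)
  have "integrable M01 (\<lambda>x. (cmod (f x))\<^sup>2)"
  proof (rule integrable_const_bound[where B = "C\<^sup>2"])
    show "AE x in M01. norm ((cmod (f x))\<^sup>2) \<le> C\<^sup>2"
      using assms(2) by (intro AE_I2) (simp add: space_restrict_space power_mono)
  qed (use assms(1) in measurable)
  then show ?thesis
    using assms(1) by (simp add: L2_def)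
qed

lemma borel_measurable_M01I: "f \<in> borel_measurable borel \<Longrightarrow> f \<in> borel_measurable M01"
  by (intro measurable_restrict_space1 measurable_completion) simp

text \<open>Affine functions are written in \<open>1\<close> and \<open>1 - x\<close> throughout:
  these are the weights of the moments \<open>mu0\<close> and \<open>mu1\<close>, so the
  coefficients match the coordinates of \<open>Gamma1\<close>. The case \<open>b = 0\<close> also
  supplies the constants.\<close>

lemma L2_affine: "(\<lambda>x. a + b * of_real (1 - x)) \<in> L2"
proof (rule L2_bounded)
  show "(\<lambda>x. a + b * complex_of_real (1 - x)) \<in> borel_measurable M01"
    by (rule borel_measurable_M01I) measurable
  show "cmod (a + b * complex_of_real (1 - x)) \<le> cmod a + cmod b" if "x \<in> {0<..<1}" for x
  proof -
    have "cmod b * \<bar>1 - x\<bar> \<le> cmod b"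
      using that by (intro mult_left_le) auto
    then show ?thesis
      using norm_triangle_ineq[of a "b * complex_of_real (1 - x)"]
      by (simp add: norm_mult del: of_real_diff)
  qed
qed

lemma L2_integrable:
  assumes "f \<in> L2"
  shows "integrable M01 f"
  using L2_mult_integrable[OF assms L2_affine[of 1 0]] by simp

lemma integral_norm_square_eq_0_AE:
  assumes "f \<in> L2" "(\<integral>x. f x * cnj (f x) \<partial>M01) = 0"
  shows "AE x in M01. f x = 0"
proof -
  have int: "integrable M01 (\<lambda>x. (cmod (f x))\<^sup>2)"
    using assms(1) by (simp add: L2_def)
  have "complex_of_real (\<integral>x. (cmod (f x))\<^sup>2 \<partial>M01) = (\<integral>x. f x * cnj (f x) \<partial>M01)"
    by (simp flip: integral_complex_of_real add: complex_norm_square del: of_real_power)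
  then have "(\<integral>x. (cmod (f x))\<^sup>2 \<partial>M01) = 0"
    using assms(2) by simp
  then have "AE x in M01. (cmod (f x))\<^sup>2 = 0"
    using int by (subst (asm) integral_nonneg_eq_0_iff_AE) auto
  then show ?thesis
    by simp
qed

section \<open>Primitives from the left and from the right\<close>

definition prim :: "(real \<Rightarrow> complex) \<Rightarrow> real \<Rightarrow> complex" where
  "prim f x = (\<integral>y. f y \<partial>lebesgue_on {0<..<x})"

text \<open>\<open>prim\<close> is the integral occurring in \<open>has_H1_deriv\<close>,
  \<open>coprim\<close> the one in \<open>J_op\<close>. They are transposes of each other for the
  bilinear pairing on \<open>M01\<close>.\<close>

definition coprim :: "(real \<Rightarrow> complex) \<Rightarrow> real \<Rightarrow> complex" where
  "coprim f x = (\<integral>y. f y \<partial>lebesgue_on {x<..<1})"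

text \<open>Moving the variable end point into the integrand keeps the measure \<open>M01\<close>
  fixed, as needed for Fubini and for almost-everywhere arguments.\<close>

lemma prim_eq:
  assumes "0 \<le> x" "x \<le> 1"
  shows "prim f x = (\<integral>y. (if y < x then f y else 0) \<partial>M01)"
  unfolding prim_def using assms
  by (auto simp: integral_restrict_space intro!: Bochner_Integration.integral_cong split: split_indicator)

lemma coprim_eq:
  assumes "0 \<le> x" "x \<le> 1"
  shows "coprim f x = (\<integral>y. (if x < y then f y else 0) \<partial>M01)"
  unfolding coprim_def using assms
  by (auto simp: integral_restrict_space intro!: Bochner_Integration.integral_cong split: split_indicator)

text \<open>End points form a null set. Passing to the gauge integral gives access to additivity
  over adjacent intervals, continuity of the indefinite integral and the fundamental theorem of
  calculus.\<close>

lemma integral_subinterval: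
  fixes f :: "real \<Rightarrow> complex"
  assumes "integrable M01 f" "0 \<le> a" "b \<le> 1"
  shows "(\<integral>y. f y \<partial>lebesgue_on {a<..<b}) = integral {a..b} f" and "f integrable_on {a..b}"
proof -
  have "set_integrable lebesgue {0<..<1} f"
    using assms(1) by (simp add: set_integrable_def integrable_restrict_space)
  then have "set_integrable lebesgue {a<..<b} f"
    by (rule set_integrable_subset) (use assms in auto)
  then have int: "integrable (lebesgue_on {a<..<b}) f"
    by (simp add: set_integrable_def integrable_restrict_space)
  show "(\<integral>y. f y \<partial>lebesgue_on {a<..<b}) = integral {a..b} f"
    by (simp add: lebesgue_integral_eq_integral[OF int] integral_open_interval_real)
  show "f integrable_on {a..b}"
    using integrable_on_lebesgue_on[OF int] by (simp add: integrable_on_open_interval_real)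
qed

lemma prim_eq_integral: "integrable M01 f \<Longrightarrow> x \<le> 1 \<Longrightarrow> prim f x = integral {0..x} f"
  unfolding prim_def by (rule integral_subinterval) auto

lemma coprim_eq_integral: "integrable M01 f \<Longrightarrow> 0 \<le> x \<Longrightarrow> coprim f x = integral {x..1} f"
  unfolding coprim_def by (rule integral_subinterval) auto

lemma prim_0 [simp]: "prim f 0 = 0"
  by (simp add: prim_def integral_restrict_space)

lemma prim_1: "prim f 1 = (\<integral>x. f x \<partial>M01)"
  by (simp add: prim_def)

lemma coprim_1 [simp]: "coprim f 1 = 0"
  by (simp add: coprim_def integral_restrict_space)

lemma prim_cnj: "prim (\<lambda>x. cnj (f x)) x = cnj (prim f x)"
  by (simp add: prim_def)

lemma coprim_eq_diff:
  assumes "integrable M01 f" "x \<in> {0..1}"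
  shows "coprim f x = (\<integral>x. f x \<partial>M01) - prim f x"
proof -
  have "integral {0..x} f + integral {x..1} f = integral {0..1} f"
    using assms by (intro Henstock_Kurzweil_Integration.integral_combine integral_subinterval) auto
  then show ?thesis
    using assms by (simp add: coprim_eq_integral prim_eq_integral eq_diff_eq add.commute flip: prim_1)
qed

lemma continuous_on_prim:
  assumes "integrable M01 f"
  shows "continuous_on {0..1} (prim f)"
proof -
  have "continuous_on {0..1} (\<lambda>x. integral {0..x} f)"
    by (rule indefinite_integral_continuous_1[OF integral_subinterval(2)[OF assms]]) auto
  then show ?thesis
    by (rule continuous_on_eq) (use assms in \<open>auto simp: prim_eq_integral\<close>)
qed

lemma continuous_on_coprim:
  assumes "integrable M01 f"
  shows "continuous_on {0..1} (coprim f)"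
proof -
  have "continuous_on {0..1} (\<lambda>x. (\<integral>x. f x \<partial>M01) - prim f x)"
    by (intro continuous_intros continuous_on_prim assms)
  then show ?thesis
    by (rule continuous_on_eq) (use assms in \<open>auto simp: coprim_eq_diff\<close>)
qed

lemma prim_has_vector_derivative:
  assumes "continuous_on {0..1} f" "integrable M01 f" "x \<in> {0..1}"
  shows "(prim f has_vector_derivative f x) (at x within {0..1})"
  by (rule has_vector_derivative_transform[OF assms(3) _ integral_has_vector_derivative[OF assms(1,3)]])
     (use assms in \<open>auto simp: prim_eq_integral\<close>)

lemma L2_continuous_on:
  assumes "continuous_on {0..1} f"
  shows "f \<in> L2"
proof -
  have "compact (f ` {0..1})"
    by (intro compact_continuous_image assms) auto
  then obtain C where "\<forall>y\<in>f ` {0..1}. cmod y \<le> C"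
    using compact_imp_bounded bounded_iff by metis
  then have C: "\<And>x. x \<in> {0..1} \<Longrightarrow> cmod (f x) \<le> C"
    by blast
  show ?thesis
  proof (rule L2_bounded)
    show "f \<in> borel_measurable M01"
      using assms by (intro continuous_imp_measurable_on_sets_lebesgue) (auto elim: continuous_on_subset)
    show "cmod (f x) \<le> C" if "x \<in> {0<..<1}" for x
      using C that by auto
  qed
qed

text \<open>Fubini on the triangle \<open>x < y\<close>. This is partial integration without
  boundary terms, and it needs only integrability.\<close>

lemma integral_mult_coprim:
  assumes f: "integrable M01 f" and g: "integrable M01 g"
  shows "(\<integral>x. f x * coprim g x \<partial>M01) = (\<integral>y. prim f y * g y \<partial>M01)"
proof -
  interpret finite_measure M01 by (rule finite_measure_M01)
  interpret pair_sigma_finite M01 M01 ..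
  define F where "F = (\<lambda>(x, y). if x < y then f x * g y else 0)"
  have [measurable]: "f \<in> borel_measurable M01" "g \<in> borel_measurable M01"
    using f g by auto
  have [measurable]: "(\<lambda>x. x) \<in> borel_measurable M01"
    by (rule borel_measurable_M01I) simp
  have meas: "F \<in> borel_measurable (M01 \<Otimes>\<^sub>M M01)"
    unfolding F_def by measurable
  \<comment> \<open>The truncated kernel is dominated by the product \<open>f x * g y\<close>, which
    is integrable on the square because both factors are.\<close>
  have "integrable (M01 \<Otimes>\<^sub>M M01) F"
  proof (rule Bochner_Integration.integrable_bound[OF _ meas])
    show "integrable (M01 \<Otimes>\<^sub>M M01) (\<lambda>(x, y). f x * g y)"
    proof (rule Fubini_integrable)
      show "integrable M01 (\<lambda>x. LINT y|M01. norm (case (x, y) of (x, y) \<Rightarrow> f x * g y))"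
        using f by (simp add: norm_mult)
    qed (use g in auto)
    show "AE z in M01 \<Otimes>\<^sub>M M01. norm (F z) \<le> norm (case z of (x, y) \<Rightarrow> f x * g y)"
      by (auto simp: F_def)
  qed
  then have "(\<integral>y. \<integral>x. F (x, y) \<partial>M01 \<partial>M01) = (\<integral>x. \<integral>y. F (x, y) \<partial>M01 \<partial>M01)"
    by (intro Fubini_integral) simp
  also have "(\<integral>x. \<integral>y. F (x, y) \<partial>M01 \<partial>M01) = (\<integral>x. f x * coprim g x \<partial>M01)"
  proof (rule Bochner_Integration.integral_cong[OF refl])
    fix x assume "x \<in> space M01"
    then have x: "0 \<le> x" "x \<le> 1" by (auto simp: space_restrict_space)
    have "f x * coprim g x = (\<integral>y. f x * (if x < y then g y else 0) \<partial>M01)"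
      by (simp add: coprim_eq x)
    then show "(\<integral>y. F (x, y) \<partial>M01) = f x * coprim g x"
      by (simp add: F_def if_distrib cong: if_cong)
  qed
  also have "(\<integral>y. \<integral>x. F (x, y) \<partial>M01 \<partial>M01) = (\<integral>y. prim f y * g y \<partial>M01)"
  proof (rule Bochner_Integration.integral_cong[OF refl])
    fix y assume "y \<in> space M01"
    then have y: "0 \<le> y" "y \<le> 1" by (auto simp: space_restrict_space)
    have "prim f y * g y = (\<integral>x. (if x < y then f x else 0) * g y \<partial>M01)"
      by (simp add: prim_eq y)
    also have "\<dots> = (\<integral>x. F (x, y) \<partial>M01)"
      by (intro Bochner_Integration.integral_cong) (auto simp: F_def)
    finally show "(\<integral>x. F (x, y) \<partial>M01) = prim f y * g y" ..
  qed
  finally show ?thesis ..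
qed

lemma coprim_const_1: "x \<in> {0..1} \<Longrightarrow> coprim (\<lambda>y. 1) x = of_real (1 - x)"
  by (simp add: coprim_def measure_restrict_space space_restrict_space of_real_def)

text \<open>Transpose the integration onto the constant \<open>1\<close>, whose
  \<open>coprim\<close> is the weight \<open>1 - x\<close> of \<open>mu1\<close>.\<close>

lemma integral_prim:
  assumes "f \<in> L2"
  shows "(\<integral>y. prim f y \<partial>M01) = mu1 f"
proof -
  have one: "integrable M01 (\<lambda>y. 1 :: complex)"
    using L2_integrable[OF L2_affine[of 1 0]] by simp
  have "(\<integral>y. prim f y \<partial>M01) = (\<integral>x. f x * coprim (\<lambda>y. 1) x \<partial>M01)"
    using integral_mult_coprim[OF L2_integrable[OF assms] one] by simp
  also have "\<dots> = mu1 f"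
    unfolding mu1_def
    by (intro Bochner_Integration.integral_cong) (auto simp: coprim_const_1 space_restrict_space)
  finally show ?thesis .
qed

section \<open>The operator \<open>P\<close> and the dual inner product on square integrable
  functions\<close>

lemma integral_const_M01 [simp]: "(\<integral>x. c \<partial>M01) = (c :: complex)"
  by (simp add: space_restrict_space)

text \<open>Subtracting the mean makes the two end point values agree. Membership matters because
  \<open>emb f\<close> is zero by convention outside \<open>H1T\<close>, so only with it is
  \<open>emb f (J_op \<phi>)\<close> the integral.\<close>

lemma J_op_in_H1T:
  assumes "\<phi> \<in> L2"
  shows "J_op \<phi> \<in> H1T"
proof -
  define \<psi> where "\<psi> = (\<lambda>x. \<phi> x - (\<integral>z. \<phi> z \<partial>M01))"
  have \<psi>: "\<psi> \<in> L2"
    unfolding \<psi>_def using L2_diff[OF assms L2_affine[of _ 0]] by simp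
  have J: "J_op \<phi> x = coprim \<psi> x" if "x \<in> {0..1}" for x
    using that by (simp add: J_op_def coprim_def \<psi>_def)
  have tot: "(\<integral>x. \<psi> x \<partial>M01) = 0"
    unfolding \<psi>_def using L2_integrable[OF assms] L2_integrable[OF L2_affine[of _ 0]]
    by (subst Bochner_Integration.integral_diff) auto
  have J': "J_op \<phi> x = - prim \<psi> x" if "x \<in> {0..1}" for x
    using J that coprim_eq_diff[OF L2_integrable[OF \<psi>] that] tot by simp
  have "has_H1_deriv (J_op \<phi>) (\<lambda>x. - \<psi> x)"
    using J' L2_cmult[OF \<psi>, of "-1"] by (auto simp: has_H1_deriv_def prim_def)
  moreover have "J_op \<phi> 0 = J_op \<phi> 1"
    using J' tot by (simp add: prim_1)
  ultimately show ?thesis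
    by (auto simp: H1T_def J_op_def)
qed

text \<open>Transposition turns the integration of \<open>\<phi>\<close> into one of
  \<open>f\<close>; the subtracted mean of \<open>\<phi>\<close> contributes the integral of
  \<open>prim f\<close>, that is \<open>mu1 f\<close>. The result exhibits a candidate for
  \<open>P_op (emb f)\<close>.\<close>

lemma emb_J_op:
  assumes f: "f \<in> L2" and \<phi>: "\<phi> \<in> L2"
  shows "emb f (J_op \<phi>) = (\<integral>y. (prim f y - mu1 f) * \<phi> y \<partial>M01)"
proof -
  define m where "m = (\<integral>z. \<phi> z \<partial>M01)"
  have \<psi>: "(\<lambda>x. \<phi> x - m) \<in> L2"
    using L2_diff[OF \<phi> L2_affine[of _ 0]] by simp
  have p: "prim f \<in> L2"
    by (intro L2_continuous_on continuous_on_prim L2_integrable f)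
  have "emb f (J_op \<phi>) = (\<integral>x. f x * coprim (\<lambda>x. \<phi> x - m) x \<partial>M01)"
    using J_op_in_H1T[OF \<phi>] unfolding emb_def
    by (auto simp: J_op_def coprim_def m_def space_restrict_space intro!: Bochner_Integration.integral_cong)
  also have "\<dots> = (\<integral>y. prim f y * (\<phi> y - m) \<partial>M01)"
    by (intro integral_mult_coprim L2_integrable f \<psi>)
  also have "\<dots> = (\<integral>y. prim f y * \<phi> y \<partial>M01) - m * mu1 f"
    using L2_mult_integrable[OF p \<phi>] L2_integrable[OF p]
    by (simp add: right_diff_distrib integral_prim[OF f])
  also have "\<dots> = (\<integral>y. (prim f y - mu1 f) * \<phi> y \<partial>M01)"
    using L2_mult_integrable[OF p \<phi>] L2_integrable[OF \<phi>]
    by (simp add: left_diff_distrib m_def)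
  finally show ?thesis .
qed

text \<open>\<open>emb_J_op\<close> provides a witness for the choice in \<open>P_op\<close>. Any
  two witnesses agree almost everywhere: test both with the conjugate of their difference.\<close>

lemma P_op_emb:
  assumes f: "f \<in> L2"
  shows "P_op (emb f) \<in> L2" and "AE x in M01. P_op (emb f) x = prim f x - mu1 f"
proof -
  let ?Q = "\<lambda>p. p \<in> L2 \<and> (\<forall>\<phi>\<in>L2. (\<integral>x. p x * \<phi> x \<partial>M01) = emb f (J_op \<phi>))"
  let ?p = "P_op (emb f)" and ?q = "\<lambda>x. prim f x - mu1 f"
  have q: "?q \<in> L2"
    by (intro L2_continuous_on continuous_intros continuous_on_prim L2_integrable f)
  have "?Q ?q"
    using q f by (simp add: emb_J_op)
  then have Q: "?Q ?p"
    unfolding P_op_def by (rule someI[of ?Q])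
  then show p: "?p \<in> L2" ..
  let ?d = "\<lambda>x. ?p x - ?q x"
  have d: "?d \<in> L2" by (rule L2_diff[OF p q])
  note d' = L2_cnj[OF d]
  have "(\<integral>x. ?d x * cnj (?d x) \<partial>M01) = (\<integral>x. ?p x * cnj (?d x) \<partial>M01) - (\<integral>x. ?q x * cnj (?d x) \<partial>M01)"
    using L2_mult_integrable[OF p d'] L2_mult_integrable[OF q d']
    by (subst left_diff_distrib) (rule Bochner_Integration.integral_diff)
  also have "\<dots> = 0"
    using Q d' f by (simp add: emb_J_op)
  finally show "AE x in M01. ?p x = ?q x"
    using integral_norm_square_eq_0_AE[OF d] by simp
qed

lemma indicator_in_H1T: "indicator {0..1} \<in> H1T"
proof -
  have "has_H1_deriv (indicator {0..1}) (\<lambda>x. 0)"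
    using L2_affine[of 0 0] by (auto simp: has_H1_deriv_def)
  then show ?thesis
    by (auto simp: H1T_def indicator_def)
qed

lemma mu0_emb: "mu0 (emb f) = (\<integral>x. f x \<partial>M01)"
  unfolding mu0_def emb_def using indicator_in_H1T
  by (auto simp: space_restrict_space intro!: Bochner_Integration.integral_cong)

text \<open>The left primitive has mean zero, so the constant \<open>mu1 h\<close> drops out on the
  right; the remaining \<open>prim h\<close> is then transposed. The test function \<open>h\<close>
  thus appears without integration, as in \<open>a_form\<close>.\<close>

lemma inner_Hm1_emb:
  assumes f: "f \<in> L2" and h: "h \<in> L2"
  shows "inner_Hm1 (emb f) (emb h) =
    inner_L2 (coprim (\<lambda>y. prim f y - mu1 f)) h + mu0 (emb f) * cnj (mu0 (emb h))"
proof -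
  let ?p = "\<lambda>y. prim f y - mu1 f" and ?q = "\<lambda>y. prim h y - mu1 h"
  have p: "?p \<in> L2" and q: "?q \<in> L2" and ph: "prim h \<in> L2"
    by (intro L2_continuous_on continuous_intros continuous_on_prim L2_integrable f h)+
  have p0: "(\<integral>y. ?p y \<partial>M01) = 0"
    using integral_prim[OF f] L2_integrable[OF p]
      L2_integrable[OF L2_continuous_on[OF continuous_on_prim[OF L2_integrable[OF f]]]]
      L2_integrable[OF L2_affine[of "mu1 f" 0]]
    by simp
  have "inner_L2 (P_op (emb f)) (P_op (emb h)) = inner_L2 ?p ?q"
    unfolding inner_L2_def
  proof (rule integral_cong_AE)
    show "AE x in M01. P_op (emb f) x * cnj (P_op (emb h) x) = ?p x * cnj (?q x)"
      using P_op_emb(2)[OF f] P_op_emb(2)[OF h] by eventually_elim simp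
  qed (intro borel_measurable_times L2_measurable L2_cnj P_op_emb f h p q)+
  also have "\<dots> = (\<integral>y. ?p y * cnj (prim h y) - cnj (mu1 h) * ?p y \<partial>M01)"
    unfolding inner_L2_def by (simp add: algebra_simps)
  also have "\<dots> = (\<integral>y. ?p y * cnj (prim h y) \<partial>M01)"
    using L2_mult_integrable[OF p L2_cnj[OF ph]] L2_integrable[OF p] p0
    by (subst Bochner_Integration.integral_diff) auto
  also have "\<dots> = (\<integral>y. prim (\<lambda>x. cnj (h x)) y * ?p y \<partial>M01)"
    by (simp add: prim_cnj mult.commute)
  also have "\<dots> = (\<integral>x. cnj (h x) * coprim ?p x \<partial>M01)"
    by (rule integral_mult_coprim[symmetric]) (intro L2_integrable L2_cnj h p)+
  finally show ?thesis
    by (simp add: inner_Hm1_def inner_L2_def mult.commute)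
qed

section \<open>Affine functions and the moment map \<open>Gamma1\<close>\<close>

lemma integral_M01_eq:
  assumes "f \<in> L2" "(f has_integral I) {0..1}"
  shows "(\<integral>x. f x \<partial>M01) = I"
  using assms prim_eq_integral[OF L2_integrable[OF assms(1)], of 1]
  by (simp add: prim_1 integral_unique)

lemma integral_affine: "(\<integral>x. a + b * of_real (1 - x) \<partial>M01) = (a + b / 2 :: complex)"
proof (rule integral_M01_eq[OF L2_affine])
  have "((\<lambda>z. a * z - b / 2 * (1 - z)\<^sup>2) has_field_derivative a + b * of_real (1 - x)) (at (of_real x))"
    for x :: real
    by (auto intro!: derivative_eq_intros simp: field_simps)
  from fundamental_theorem_of_calculus[OF _ has_vector_derivative_real_field[OF this], of 0 1]
  show "((\<lambda>x. a + b * of_real (1 - x)) has_integral a + b / 2) {0..1}"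
    by simp
qed

lemma mu1_affine: "mu1 (\<lambda>x. a + b * of_real (1 - x)) = a / 2 + b / 3"
proof -
  have "((\<lambda>x. of_real (1 - x) * (a + b * of_real (1 - x))) has_integral a / 2 + b / 3) {0..1}"
  proof -
    have "((\<lambda>z. - a / 2 * (1 - z)\<^sup>2 - b / 3 * (1 - z) ^ 3) has_field_derivative
        of_real (1 - x) * (a + b * of_real (1 - x))) (at (of_real x))" for x :: real
      by (auto intro!: derivative_eq_intros simp: field_simps power2_eq_square)
    from fundamental_theorem_of_calculus[OF _ has_vector_derivative_real_field[OF this], of 0 1]
    show ?thesis
      by (simp add: add.commute)
  qed
  moreover have "(\<lambda>x. of_real (1 - x) * (a + b * of_real (1 - x))) \<in> L2"
    by (intro L2_continuous_on continuous_intros)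
  ultimately show ?thesis
    unfolding mu1_def by (intro integral_M01_eq)
qed

lemma vector_2_eq_iff: "(x :: 'a ^ 2) = y \<longleftrightarrow> x $ 1 = y $ 1 \<and> x $ 2 = y $ 2"
  by (simp add: vec_eq_iff forall_2)

lemma inner_C2_eq: "inner_C2 a b = a $ 1 * cnj (b $ 1) + a $ 2 * cnj (b $ 2)"
  by (simp add: inner_C2_def sum_2)

lemma Gamma1_nth [simp]:
  "Gamma1 f $ 1 = (\<integral>x. f x \<partial>M01)" "Gamma1 f $ 2 = mu1 f"
  by (simp_all add: Gamma1_def mu0_emb)

lemma Gamma1_surj:
  obtains a b where "Gamma1 (\<lambda>x. a + b * of_real (1 - x)) = y"
proof
  \<comment> \<open>The matrix with rows \<open>(4, -6)\<close> and \<open>(-6, 12)\<close> is the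
    inverse of the Gram matrix of \<open>1\<close> and \<open>1 - x\<close>, whose rows are
    \<open>(1, 1/2)\<close> and \<open>(1/2, 1/3)\<close>.\<close>
  show "Gamma1 (\<lambda>x. (4 * y $ 1 - 6 * y $ 2) + (12 * y $ 2 - 6 * y $ 1) * of_real (1 - x)) = y"
    by (simp add: vector_2_eq_iff integral_affine mu1_affine del: of_real_diff) (simp add: field_simps)
qed

lemma L2_weight:
  assumes "f \<in> L2"
  shows "integrable M01 (\<lambda>x. of_real (1 - x) * f x)"
  using L2_mult_integrable[OF L2_affine[of 0 1] assms] by simp

text \<open>The weights \<open>1\<close> and \<open>1 - x\<close> are real, so conjugating
  \<open>h\<close> conjugates its moments. An affine function therefore sees \<open>h\<close> only
  through \<open>Gamma1 h\<close>.\<close>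

lemma inner_L2_affine:
  assumes "h \<in> L2"
  shows "inner_L2 (\<lambda>x. a + b * of_real (1 - x)) h = inner_C2 (vector [a, b]) (Gamma1 h)"
proof -
  have "inner_L2 (\<lambda>x. a + b * of_real (1 - x)) h
      = (\<integral>x. a * cnj (h x) + b * cnj (of_real (1 - x) * h x) \<partial>M01)"
    unfolding inner_L2_def by (simp add: algebra_simps)
  also have "\<dots> = a * cnj (\<integral>x. h x \<partial>M01) + b * cnj (mu1 h)"
    unfolding mu1_def using L2_integrable[OF assms] L2_weight[OF assms]
    by (subst Bochner_Integration.integral_add) (auto simp del: complex_cnj_mult)
  finally show ?thesis
    by (simp add: inner_C2_eq)
qed

lemma inner_L2_diff_left:
  assumes "f \<in> L2" "g \<in> L2" "h \<in> L2"
  shows "inner_L2 (\<lambda>x. f x - g x) h = inner_L2 f h - inner_L2 g h"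
  unfolding inner_L2_def left_diff_distrib
  by (intro Bochner_Integration.integral_diff L2_mult_integrable L2_cnj assms)

lemma Gamma1_diff:
  assumes "f \<in> L2" "g \<in> L2"
  shows "Gamma1 (\<lambda>x. f x - g x) = Gamma1 f - Gamma1 g"
  using L2_integrable[OF assms(1)] L2_integrable[OF assms(2)] L2_weight[OF assms(1)] L2_weight[OF assms(2)]
  by (simp add: vector_2_eq_iff mu1_def right_diff_distrib del: of_real_diff)

text \<open>The kernel of \<open>Gamma1\<close> is the orthogonal complement of the affine functions.\<close>

lemma affine_AE_of_orthogonal:
  assumes d: "d \<in> L2" and orth: "\<And>h. h \<in> L2 \<Longrightarrow> Gamma1 h = 0 \<Longrightarrow> inner_L2 d h = 0"
  obtains a b where "AE x in M01. d x = a + b * of_real (1 - x)"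
proof -
  obtain a b where ab: "Gamma1 (\<lambda>x. a + b * of_real (1 - x)) = Gamma1 d"
    by (rule Gamma1_surj)
  \<comment> \<open>The remainder has vanishing moments, hence is orthogonal to \<open>d\<close> by
    hypothesis and to affine functions by \<open>inner_L2_affine\<close>, and so to itself.\<close>
  let ?r = "\<lambda>x. d x - (a + b * of_real (1 - x))"
  have r: "?r \<in> L2" by (rule L2_diff[OF d L2_affine])
  have "Gamma1 ?r = 0"
    by (simp add: Gamma1_diff[OF d L2_affine] ab del: of_real_diff)
  then have "inner_L2 ?r ?r = 0"
    using inner_L2_diff_left[OF d L2_affine r, of a b] orth[OF r] inner_L2_affine[OF r, of a b]
    by (simp add: inner_C2_eq)
  then have "AE x in M01. ?r x = 0"
    using r by (intro integral_norm_square_eq_0_AE) (simp_all add: inner_L2_def)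
  then show ?thesis
    by (intro that[of a b]) simp
qed

text \<open>Every vector of \<open>Y\<close> is attained as \<open>Gamma1 h\<close> with
  \<open>h\<close> affine, so testing with \<open>V_sp Y\<close> reaches all of
  \<open>Y\<close>.\<close>

lemma orth_C2I_Gamma1:
  assumes "\<And>h. h \<in> V_sp Y \<Longrightarrow> inner_C2 z (Gamma1 h) = 0"
  shows "z \<in> orth_C2 Y"
  unfolding orth_C2_def
proof safe
  fix y assume "y \<in> Y"
  obtain a b where "Gamma1 (\<lambda>x. a + b * of_real (1 - x)) = y"
    by (rule Gamma1_surj)
  then show "inner_C2 z y = 0"
    using assms \<open>y \<in> Y\<close> L2_affine by (auto simp: V_sp_def)
qed

section \<open>From the weak equation to a boundary value problem\<close>

lemma coprim_has_vector_derivative: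
  assumes "continuous_on {0..1} f" "x \<in> {0..1}"
  shows "(coprim f has_vector_derivative - f x) (at x within {0..1})"
proof (rule has_vector_derivative_transform[OF assms(2)])
  have int: "integrable M01 f"
    by (intro L2_integrable L2_continuous_on assms)
  show "coprim f y = (\<integral>x. f x \<partial>M01) - prim f y" if "y \<in> {0..1}" for y
    by (rule coprim_eq_diff[OF int that])
  show "((\<lambda>y. (\<integral>x. f x \<partial>M01) - prim f y) has_vector_derivative - f x) (at x within {0..1})"
    using prim_has_vector_derivative[OF assms(1) int assms(2)]
    by (auto intro!: derivative_eq_intros)
qed

text \<open>The equation is \<open>f'' = g\<close>; \<open>F\<close> is the continuous representative of \<open>f\<close>, and \<open>F'\<close> that of \<open>f'\<close>.\<close>

definition strong_solution :: "(complex ^ 2) set \<Rightarrow> complex ^ 2 ^ 2 \<Rightarrow> (real \<Rightarrow> complex) \<Rightarrow>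
    (real \<Rightarrow> complex) \<Rightarrow> (real \<Rightarrow> complex) \<Rightarrow> (real \<Rightarrow> complex) \<Rightarrow> bool" where
  "strong_solution Y K f g F F' \<longleftrightarrow>
    (AE x in M01. f x = F x) \<and>
    (\<forall>x\<in>{0..1}. (F has_vector_derivative F' x) (at x within {0..1})) \<and>
    (\<forall>x\<in>{0..1}. F' x = F' 0 + prim g x) \<and>
    Gamma1 g = vector [F' 1 - F' 0, F 1 - F 0 - F' 0] \<and>
    K *v Gamma1 f + vector [F' 1 - F' 0 + F 1, F 0 - F 1] \<in> orth_C2 Y"

text \<open>By \<open>inner_Hm1_emb\<close> the weak equation equates \<open>L2\<close> pairings
  with \<open>h\<close> up to terms depending on \<open>Gamma1 h\<close> alone. Taking
  \<open>Gamma1 h = 0\<close> shows that \<open>f\<close> is a double primitive of \<open>g\<close>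
  plus an affine function; general \<open>h\<close> then constrains the two affine coefficients. The
  minus sign is that of the generator \<open>-A\<close>.\<close>

lemma strong_solution_exists:
  assumes Y: "vec.subspace Y" and f: "f \<in> V_sp Y" and g: "g \<in> L2"
    and weak: "\<And>h. h \<in> V_sp Y \<Longrightarrow> a_form K f h = inner_Hm1 (emb (\<lambda>x. - g x)) (emb h)"
  shows "\<exists>F F'. strong_solution Y K f g F F'"
proof -
  have Y0: "0 \<in> Y" by (rule vec.subspace_0[OF Y])
  have f2: "f \<in> L2" using f by (simp add: V_sp_def)
  have g': "(\<lambda>x. - g x) \<in> L2" using L2_cmult[OF g, of "-1"] by simp
  define p where "p = (\<lambda>y. prim (\<lambda>x. - g x) y - mu1 (\<lambda>x. - g x))"
  have p_eq: "p y = mu1 g - prim g y" for y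
    by (simp add: p_def prim_def mu1_def)
  have cont_p: "continuous_on {0..1} p"
    unfolding p_def by (intro continuous_intros continuous_on_prim L2_integrable g')
  have p: "p \<in> L2" by (rule L2_continuous_on[OF cont_p])
  \<comment> \<open>\<open>p\<close> has mean zero, so the double primitive \<open>H\<close> below
    vanishes at both end points.\<close>
  have p0: "coprim p 0 = 0"
    using integral_prim[OF g] L2_integrable[OF L2_continuous_on[OF continuous_on_prim[OF L2_integrable[OF g]]]]
      L2_integrable[OF L2_affine[of "mu1 g" 0]]
    by (simp add: coprim_def p_eq)
  define H where "H = coprim p"
  have H: "H \<in> L2"
    unfolding H_def by (intro L2_continuous_on continuous_on_coprim L2_integrable p)
  let ?d = "\<lambda>x. f x - H x"
  have d: "?d \<in> L2" by (rule L2_diff[OF f2 H])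
  \<comment> \<open>The first coordinate collects the \<open>mu0\<close> term of the dual inner
    product; the \<open>K\<close> term comes from the form.\<close>
  have key: "inner_L2 ?d h = inner_C2 (vector [mu0 (emb (\<lambda>x. - g x)), 0] - K *v Gamma1 f) (Gamma1 h)"
    if "h \<in> V_sp Y" for h
  proof -
    have h: "h \<in> L2" using that by (simp add: V_sp_def)
    show ?thesis
      using weak[OF that]
      unfolding inner_L2_diff_left[OF f2 H h] inner_Hm1_emb[OF g' h, folded p_def H_def] a_form_def
      by (simp add: inner_C2_eq mu0_emb algebra_simps)
  qed
  obtain a b where ab: "AE x in M01. ?d x = a + b * of_real (1 - x)"
  proof (rule affine_AE_of_orthogonal[OF d])
    fix h assume h: "h \<in> L2" "Gamma1 h = 0"
    then have "h \<in> V_sp Y" using Y0 by (simp add: V_sp_def)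
    from key[OF this] h(2) show "inner_L2 ?d h = 0"
      by (simp add: inner_C2_eq)
  qed
  define F where "F = (\<lambda>x. H x + (a + b * of_real (1 - x)))"
  define F' where "F' = (\<lambda>x. - p x - b)"
  show ?thesis
    unfolding strong_solution_def
  proof (rule exI[of _ F], rule exI[of _ F'], intro conjI ballI)
    show "AE x in M01. f x = F x"
      using ab by eventually_elim (simp add: F_def algebra_simps)
    show "(F has_vector_derivative F' x) (at x within {0..1})" if "x \<in> {0..1}" for x
      unfolding F_def F'_def H_def
      by (auto intro!: derivative_eq_intros coprim_has_vector_derivative[OF cont_p that])
    show "F' x = F' 0 + prim g x" if "x \<in> {0..1}" for x
      by (simp add: F'_def p_eq)
    show "Gamma1 g = vector [F' 1 - F' 0, F 1 - F 0 - F' 0]"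
      by (simp add: vector_2_eq_iff F_def F'_def H_def p0 p_eq prim_1)
    show "K *v Gamma1 f + vector [F' 1 - F' 0 + F 1, F 0 - F 1] \<in> orth_C2 Y"
    proof (rule orth_C2I_Gamma1)
      fix h assume hV: "h \<in> V_sp Y"
      then have h: "h \<in> L2" by (simp add: V_sp_def)
      have "inner_L2 ?d h = inner_L2 (\<lambda>x. a + b * of_real (1 - x)) h"
        unfolding inner_L2_def
      proof (rule integral_cong_AE)
        show "AE x in M01. (f x - H x) * cnj (h x) = (a + b * of_real (1 - x)) * cnj (h x)"
          using ab by eventually_elim simp
      qed (intro borel_measurable_times L2_measurable L2_cnj d h L2_affine)+
      then have eq: "inner_C2 (vector [mu0 (emb (\<lambda>x. - g x)), 0] - K *v Gamma1 f) (Gamma1 h) =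
          inner_C2 (vector [a, b]) (Gamma1 h)"
        by (simp only: key[OF hV] inner_L2_affine[OF h])
      \<comment> \<open>Since \<open>H\<close> vanishes at the end points, \<open>F 1 = a\<close>
        and \<open>F 0 - F 1 = b\<close>, while \<open>F' 1 - F' 0\<close> is the integral of
        \<open>g\<close>.\<close>
      have bdry: "vector [F' 1 - F' 0 + F 1, F 0 - F 1] =
          (vector [a, b] - vector [mu0 (emb (\<lambda>x. - g x)), 0] :: complex ^ 2)"
        by (simp add: vector_2_eq_iff F_def F'_def H_def p0 p_eq prim_1 mu0_emb)
      have "inner_C2 (k + (v - m)) w = inner_C2 v w - inner_C2 (m - k) w" for k v m w
        by (simp add: inner_C2_eq algebra_simps)
      then show "inner_C2 (K *v Gamma1 f + vector [F' 1 - F' 0 + F 1, F 0 - F 1]) (Gamma1 h) = 0"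
        unfolding bdry by (simp add: eq)
    qed
  qed
qed

section \<open>Change of representative and iterated derivatives\<close>

lemma prim_cong_AE:
  assumes "f \<in> borel_measurable M01" "g \<in> borel_measurable M01" "AE x in M01. f x = g x" "x \<in> {0..1}"
  shows "prim f x = prim g x"
proof -
  have [measurable]: "(\<lambda>x. x) \<in> borel_measurable M01"
    by (rule borel_measurable_M01I) simp
  note [measurable] = assms(1,2)
  have "(\<integral>y. (if y < x then f y else 0) \<partial>M01) = (\<integral>y. (if y < x then g y else 0) \<partial>M01)"
    by (rule integral_cong_AE) (measurable, use assms(3) in \<open>eventually_elim, simp\<close>)
  then show ?thesis
    using assms(4) by (simp add: prim_eq)
qed

lemma H1T_measurable:
  assumes "\<phi> \<in> H1T"
  shows "\<phi> \<in> borel_measurable M01"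
proof -
  obtain v where v: "v \<in> L2" "\<And>x. x \<in> {0..1} \<Longrightarrow> \<phi> x = \<phi> 0 + prim v x"
    using assms unfolding H1T_def has_H1_deriv_def prim_def by blast
  have "continuous_on {0..1} (\<lambda>x. \<phi> 0 + prim v x)"
    by (intro continuous_intros continuous_on_prim L2_integrable v)
  then have "continuous_on {0..1} \<phi>"
    by (rule continuous_on_eq) (rule v(2)[symmetric])
  then show ?thesis
    by (intro L2_measurable L2_continuous_on)
qed

text \<open>Allows a solution to be replaced by its continuous representative without changing the
  functional.\<close>

lemma emb_cong_AE:
  assumes "f \<in> borel_measurable M01" "g \<in> borel_measurable M01" "AE x in M01. f x = g x"
  shows "emb f = emb g"
proof
  fix \<phi>
  have "(\<integral>x. f x * \<phi> x \<partial>M01) = (\<integral>x. g x * \<phi> x \<partial>M01)" if "\<phi> \<in> H1T"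
  proof (rule integral_cong_AE)
    show "AE x in M01. f x * \<phi> x = g x * \<phi> x"
      using assms(3) by eventually_elim simp
  qed (intro borel_measurable_times assms H1T_measurable that)+
  then show "emb f \<phi> = emb g \<phi>"
    by (simp add: emb_def)
qed

text \<open>A derivative within \<open>[0,1]\<close> is unique and depends only on values in
  \<open>[0,1]\<close>, so the induction needs agreement there only.\<close>

lemma nderiv01_chain:
  assumes "\<And>n x. x \<in> {0..1} \<Longrightarrow> (G n has_vector_derivative G (Suc n) x) (at x within {0..1})"
  shows "x \<in> {0..1} \<Longrightarrow> nderiv01 n (G 0) x = G n x"
    and "smooth01 (G 0)"
proof -
  show eq: "nderiv01 n (G 0) x = G n x" if "x \<in> {0..1}" for n x
    using that
  proof (induction n arbitrary: x)
    case 0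
    then show ?case by (simp add: nderiv01_def)
  next
    case (Suc n)
    have "(nderiv01 n (G 0) has_vector_derivative G (Suc n) x) (at x within {0..1})"
      by (rule has_vector_derivative_transform[OF Suc.prems Suc.IH assms[OF Suc.prems]])
    then have "vector_derivative (nderiv01 n (G 0)) (at x within {0..1}) = G (Suc n) x"
      using Suc.prems by (intro vector_derivative_within_closed_interval) auto
    then show ?case
      by (simp add: nderiv01_def)
  qed
  show "smooth01 (G 0)"
    unfolding smooth01_def
  proof safe
    fix n and x :: real assume x: "x \<in> {0..1}"
    have "(nderiv01 n (G 0) has_vector_derivative G (Suc n) x) (at x within {0..1})"
      by (rule has_vector_derivative_transform[OF x eq assms[OF x]])
    then show "nderiv01 n (G 0) differentiable at x within {0..1}"
      by (rule differentiableI_vector)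
  qed
qed

section \<open>Smoothing by analytic semigroups\<close>

lemma sector_of_real: "0 < \<theta> \<Longrightarrow> 0 < t \<Longrightarrow> complex_of_real t \<in> sector \<theta>"
  by (simp add: sector_def)

text \<open>
  Applying the bounded operator \<open>T (t / 2)\<close> to the difference quotient at \<open>t / 2\<close> gives the one at
  \<open>t\<close>, so the derivative at \<open>t\<close> lies in the range of \<open>T (t / 2)\<close> and the step can be iterated.
\<close>

lemma generator_graph_step:
  assumes T: "analytic_semigroup X N T"
    and add: "\<And>x y. x \<in> X \<Longrightarrow> y \<in> X \<Longrightarrow> (\<lambda>s. x s + y s) \<in> X"
    and cmult: "\<And>c x. x \<in> X \<Longrightarrow> (\<lambda>s. c * x s) \<in> X"
    and N: "\<And>x. N x \<ge> 0"
    and x: "x \<in> X" and t: "0 < t"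
  shows "\<exists>y\<in>X. (T t x, T (t / 2) y) \<in> generator_graph X N T"
proof -
  from T obtain \<theta> S where \<theta>: "0 < \<theta>" and S: "holomorphic_semigroup \<theta> X N S"
    and TS: "\<And>t x. t \<ge> 0 \<Longrightarrow> x \<in> X \<Longrightarrow> T t x = S (of_real t) x"
    unfolding analytic_semigroup_def by blast
  note sec = sector_of_real[OF \<theta>]
  have lin: "bounded_linear_operator_on X N (T r)" if "r > 0" for r
  proof -
    have "bounded_linear_operator_on X N (S (of_real r))"
      using S sec[OF that] unfolding holomorphic_semigroup_def by blast
    then show ?thesis
      using that by (simp add: bounded_linear_operator_on_def TS add cmult)
  qed
  have TX: "T r z \<in> X" if "r > 0" "z \<in> X" for r z
    using lin[OF that(1)] that(2) by (simp add: bounded_linear_operator_on_def)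
  have semi: "T (r + q) z = T r (T q z)" if "r > 0" "q > 0" "z \<in> X" for r q z
  proof -
    have "S (of_real r + of_real q) z = S (of_real r) (S (of_real q) z)"
      using S sec[of r] sec[of q] sec[of "r + q"] that
      unfolding holomorphic_semigroup_def by simp
    then show ?thesis
      using that TX[of q z] by (simp add: TS)
  qed
  define r where "r = t / 2"
  have r: "r > 0" using t by (simp add: r_def)
  obtain y where y: "y \<in> X" and
    lim: "((\<lambda>w. N (\<lambda>s. (S w x s - S (of_real r) x s) / (w - of_real r) - y s)) \<longlongrightarrow> 0) (at (of_real r))"
    using S sec[OF r] x unfolding holomorphic_semigroup_def by blast
  obtain C where C: "\<And>z. z \<in> X \<Longrightarrow> N (T r z) \<le> C * N z"
    using lin[OF r] unfolding bounded_linear_operator_on_def by blast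
  define D where "D h = (\<lambda>s. (T (r + h) x s - T r x s) / of_real h - y s)" for h
  \<comment> \<open>Holomorphy gives a limit over complex increments; it is restricted to real
    \<open>h > 0\<close>, for which \<open>r + h\<close> avoids the base point.\<close>
  have "filterlim (\<lambda>h. complex_of_real (r + h)) (at (of_real r)) (at_right 0)"
  proof (rule filterlim_atI)
    have "((\<lambda>h. complex_of_real (r + h)) \<longlongrightarrow> of_real (r + 0)) (at_right 0)"
      by (intro tendsto_intros)
    then show "((\<lambda>h. complex_of_real (r + h)) \<longlongrightarrow> of_real r) (at_right 0)"
      by simp
    show "\<forall>\<^sub>F h in at_right 0. complex_of_real (r + h) \<noteq> of_real r"
      by (auto simp: eventually_at_right_less intro: eventually_mono[OF eventually_at_right_less[of 0]])
  qed
  from filterlim_compose[OF lim this]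
  have "((\<lambda>h. N (D h)) \<longlongrightarrow> 0) (at_right 0)"
  proof (rule Lim_transform_eventually)
    show "\<forall>\<^sub>F h in at_right 0. N (\<lambda>s. (S (complex_of_real (r + h)) x s - S (complex_of_real r) x s) /
        (complex_of_real (r + h) - complex_of_real r) - y s) = N (D h)"
      using eventually_at_right_less[of 0]
      by eventually_elim (use r x in \<open>simp add: D_def TS\<close>)
  qed
  then have lim': "((\<lambda>h. C * N (D h)) \<longlongrightarrow> 0) (at_right 0)"
    by (rule tendsto_mult_right_zero)
  let ?E = "\<lambda>h s. (T h (T t x) s - T t x s) / of_real h - T r y s"
  have E: "?E h = T r (D h)" "D h \<in> X" if h: "h > 0" for h
  proof -
    let ?p = "T (r + h) x" and ?q = "T r x"
    have p: "?p \<in> X" and q: "?q \<in> X" using TX r h x by auto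
    \<comment> \<open>The quotient is decomposed into sums and scalar multiples, the operations
      under which \<open>X\<close> is closed and \<open>T r\<close> is linear.\<close>
    let ?u = "\<lambda>s. (1 / of_real h) * ?p s" and ?v = "\<lambda>s. (- 1 / of_real h) * ?q s" and ?w = "\<lambda>s. - 1 * y s"
    have u: "?u \<in> X" and v: "?v \<in> X" and w: "?w \<in> X"
      by (intro cmult p q y)+
    have D: "D h = (\<lambda>s. (\<lambda>s. ?u s + ?v s) s + ?w s)"
      by (auto simp: D_def diff_divide_distrib)
    show "D h \<in> X"
      unfolding D by (intro add u v w)
    have L: "\<And>a b. a \<in> X \<Longrightarrow> b \<in> X \<Longrightarrow> T r (\<lambda>s. a s + b s) = (\<lambda>s. T r a s + T r b s)"
      "\<And>c a. a \<in> X \<Longrightarrow> T r (\<lambda>s. c * a s) = (\<lambda>s. c * T r a s)"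
      using lin[OF r] unfolding bounded_linear_operator_on_def by blast+
    have "T r (D h) = (\<lambda>s. 1 / of_real h * T r ?p s + - 1 / of_real h * T r ?q s + - 1 * T r y s)"
      unfolding D L(1)[OF add[OF u v] w] L(1)[OF u v] L(2)[OF p] L(2)[OF q] L(2)[OF y] by simp
    \<comment> \<open>As \<open>r + r = t\<close>, the first two expressions both equal
      \<open>T (t + h) x\<close>.\<close>
    moreover have "T r ?p = T h (T t x)" "T r ?q = T t x"
      using semi[of r "r + h" x] semi[of h t x] semi[of r r x] r t h x
      by (auto simp: r_def add_ac)
    ultimately show "?E h = T r (D h)"
      by (auto simp: diff_divide_distrib)
  qed
  have "((\<lambda>h. N (?E h)) \<longlongrightarrow> 0) (at_right 0)"
  proof (rule tendsto_sandwich[OF _ _ tendsto_const lim'])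
    show "\<forall>\<^sub>F h in at_right 0. 0 \<le> N (?E h)"
      by (simp add: N)
    show "\<forall>\<^sub>F h in at_right 0. N (?E h) \<le> C * N (D h)"
      using eventually_at_right_less[of 0]
    proof eventually_elim
      case (elim h)
      show ?case
        unfolding E(1)[OF elim] by (rule C[OF E(2)[OF elim]])
    qed
  qed
  then have "(T t x, T r y) \<in> generator_graph X N T"
    using TX[OF t x] TX[OF r y] by (simp add: generator_graph_def)
  then show ?thesis
    using y unfolding r_def by (rule bexI)
qed

text \<open>The second component \<open>T (t / 2) y\<close> again has the form of a first component,
  at half the time. Choosing successively gives \<open>w n = T (t / 2 ^ n) (xs n)\<close> with
  \<open>xs n\<close> in \<open>X\<close>; the times stay positive, so the step always
  applies.\<close>

lemma generator_graph_chain: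
  assumes T: "analytic_semigroup X N T"
    and add: "\<And>x y. x \<in> X \<Longrightarrow> y \<in> X \<Longrightarrow> (\<lambda>s. x s + y s) \<in> X"
    and cmult: "\<And>c x. x \<in> X \<Longrightarrow> (\<lambda>s. c * x s) \<in> X"
    and N: "\<And>x. N x \<ge> 0"
    and x: "x \<in> X" and t: "0 < t"
  obtains w where "w 0 = T t x" "\<And>n. (w n, w (Suc n)) \<in> generator_graph X N T"
proof -
  have "\<exists>y. y \<in> X \<and> (T t x, T (t / 2) y) \<in> generator_graph X N T" if "x \<in> X" "0 < t" for t x
    using generator_graph_step[OF T add cmult N that] by blast
  note ex = someI_ex[OF this]
  define f where "f t x = (SOME y. y \<in> X \<and> (T t x, T (t / 2) y) \<in> generator_graph X N T)" for t x
  have f: "f t x \<in> X \<and> (T t x, T (t / 2) (f t x)) \<in> generator_graph X N T" if "x \<in> X" "0 < t" for t x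
    unfolding f_def by (rule ex[OF that])
  define xs where "xs = rec_nat x (\<lambda>n. f (t / 2 ^ n))"
  have xs: "xs 0 = x" "xs (Suc n) = f (t / 2 ^ n) (xs n)" for n
    by (simp_all add: xs_def)
  have X: "xs n \<in> X" for n
  proof (induction n)
    case (Suc n)
    then show ?case
      using f[of "xs n" "t / 2 ^ n"] t by (simp add: xs)
  qed (simp add: xs x)
  show ?thesis
  proof
    show "T (t / 2 ^ 0) (xs 0) = T t x"
      by (simp add: xs)
    show "(T (t / 2 ^ n) (xs n), T (t / 2 ^ Suc n) (xs (Suc n))) \<in> generator_graph X N T" for n
      using f[OF X, of "t / 2 ^ n" n] t by (simp add: xs mult.commute)
  qed
qed

section \<open>Vector space structure of \<open>H_sp Y\<close> and positivity of its norm\<close>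

lemma Hm1D:
  assumes "F \<in> Hm1"
  shows "\<phi> \<notin> H1T \<Longrightarrow> F \<phi> = 0"
    and "\<phi> \<in> H1T \<Longrightarrow> \<psi> \<in> H1T \<Longrightarrow> F (\<lambda>x. \<phi> x + \<psi> x) = F \<phi> + F \<psi>"
    and "\<phi> \<in> H1T \<Longrightarrow> F (\<lambda>x. c * \<phi> x) = c * F \<phi>"
  using assms unfolding Hm1_def by blast+

text \<open>The derivative is a separate argument because \<open>has_H1_deriv\<close> only relates
  it to \<open>\<phi>\<close>.\<close>

definition H1_norm :: "(real \<Rightarrow> complex) \<Rightarrow> (real \<Rightarrow> complex) \<Rightarrow> real" where
  "H1_norm \<phi> \<phi>' = sqrt ((\<integral>x. (cmod (\<phi> x))\<^sup>2 \<partial>M01) + (\<integral>x. (cmod (\<phi>' x))\<^sup>2 \<partial>M01))"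

lemma Hm1_bound:
  assumes "F \<in> Hm1"
  obtains C where "\<And>\<phi> \<phi>'. \<phi> \<in> H1T \<Longrightarrow> has_H1_deriv \<phi> \<phi>' \<Longrightarrow> cmod (F \<phi>) \<le> C * H1_norm \<phi> \<phi>'"
  using assms unfolding Hm1_def H1_norm_def by blast

lemma Hm1I:
  assumes "\<And>\<phi>. \<phi> \<notin> H1T \<Longrightarrow> F \<phi> = 0"
    and "\<And>\<phi> \<psi>. \<phi> \<in> H1T \<Longrightarrow> \<psi> \<in> H1T \<Longrightarrow> F (\<lambda>x. \<phi> x + \<psi> x) = F \<phi> + F \<psi>"
    and "\<And>c \<phi>. \<phi> \<in> H1T \<Longrightarrow> F (\<lambda>x. c * \<phi> x) = c * F \<phi>"
    and "\<And>\<phi> \<phi>'. \<phi> \<in> H1T \<Longrightarrow> has_H1_deriv \<phi> \<phi>' \<Longrightarrow> cmod (F \<phi>) \<le> C * H1_norm \<phi> \<phi>'"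
  shows "F \<in> Hm1"
  using assms unfolding Hm1_def H1_norm_def by blast

lemma Hm1_add:
  assumes "F \<in> Hm1" "G \<in> Hm1"
  shows "(\<lambda>s. F s + G s) \<in> Hm1"
proof -
  obtain C where C: "\<And>\<phi> \<phi>'. \<phi> \<in> H1T \<Longrightarrow> has_H1_deriv \<phi> \<phi>' \<Longrightarrow> cmod (F \<phi>) \<le> C * H1_norm \<phi> \<phi>'"
    using Hm1_bound[OF assms(1)] by blast
  obtain D where D: "\<And>\<phi> \<phi>'. \<phi> \<in> H1T \<Longrightarrow> has_H1_deriv \<phi> \<phi>' \<Longrightarrow> cmod (G \<phi>) \<le> D * H1_norm \<phi> \<phi>'"
    using Hm1_bound[OF assms(2)] by blast
  show ?thesis
  proof (rule Hm1I)
    show "cmod (F \<phi> + G \<phi>) \<le> (C + D) * H1_norm \<phi> \<phi>'" if "\<phi> \<in> H1T" "has_H1_deriv \<phi> \<phi>'" for \<phi> \<phi>'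
      unfolding distrib_right by (rule norm_triangle_mono[OF C[OF that] D[OF that]])
  qed (simp_all add: Hm1D[OF assms(1)] Hm1D[OF assms(2)] distrib_left)
qed

lemma Hm1_cmult:
  assumes "F \<in> Hm1"
  shows "(\<lambda>s. c * F s) \<in> Hm1"
proof -
  obtain C where C: "\<And>\<phi> \<phi>'. \<phi> \<in> H1T \<Longrightarrow> has_H1_deriv \<phi> \<phi>' \<Longrightarrow> cmod (F \<phi>) \<le> C * H1_norm \<phi> \<phi>'"
    using Hm1_bound[OF assms] by blast
  show ?thesis
  proof (rule Hm1I)
    show "cmod (c * F \<phi>) \<le> (cmod c * C) * H1_norm \<phi> \<phi>'" if "\<phi> \<in> H1T" "has_H1_deriv \<phi> \<phi>'" for \<phi> \<phi>'
      using C[OF that] by (simp add: norm_mult mult.assoc mult_left_mono)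
  qed (simp_all add: Hm1D[OF assms] distrib_left)
qed

lemma H_sp_add: "F \<in> H_sp Y \<Longrightarrow> G \<in> H_sp Y \<Longrightarrow> (\<lambda>s. F s + G s) \<in> H_sp Y"
  by (auto simp: H_sp_def Hm1_add mu0_def split: if_splits)

lemma H_sp_cmult: "F \<in> H_sp Y \<Longrightarrow> (\<lambda>s. c * F s) \<in> H_sp Y"
  by (auto simp: H_sp_def Hm1_cmult mu0_def split: if_splits)

text \<open>Both summands of the inner product are real and nonnegative, whatever
  \<open>P_op F\<close> is. This has to be checked, since \<open>sqrt\<close> of a negative number
  is negative in HOL.\<close>

lemma norm_Hm1_nonneg: "norm_Hm1 F \<ge> 0"
proof -
  have "inner_L2 (P_op F) (P_op F) = complex_of_real (\<integral>x. (cmod (P_op F x))\<^sup>2 \<partial>M01)"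
    by (simp flip: integral_complex_of_real add: inner_L2_def complex_norm_square del: of_real_power)
  moreover have "mu0 F * cnj (mu0 F) = complex_of_real ((cmod (mu0 F))\<^sup>2)"
    by (simp add: complex_norm_square del: of_real_power)
  ultimately show ?thesis
    by (simp add: norm_Hm1_def inner_Hm1_def)
qed

section \<open>The chain of strong solutions at a fixed time\<close>

theorem corollary3p10:
  fixes Y :: "(complex ^ 2) set"
    and K :: "complex ^ 2 ^ 2"
    and u\<^sub>0 :: functional
    and T :: "real \<Rightarrow> functional \<Rightarrow> functional"
    and u :: "real \<Rightarrow> functional"
  assumes "vec.subspace Y"
    and "u\<^sub>0 \<in> H_sp Y"
    and "analytic_semigroup_of_neg (H_sp Y) norm_Hm1 (A_graph Y K) T"
    and "\<And>t. t \<ge> 0 \<Longrightarrow> u t = T t u\<^sub>0"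
  shows "\<forall>t>0. \<exists>v. smooth01 v \<and> u t = emb v \<and>
    (\<forall>h::nat. h \<ge> 1 \<longrightarrow>
      (let D = \<lambda>j. nderiv01 j v;
           b = vector [D (2*h - 1) 1 - D (2*h - 1) 0,
                       D (2*h - 2) 1 - D (2*h - 2) 0 - D (2*h - 1) 0] :: complex ^ 2
       in b \<in> Y \<and>
          K *v b + vector [D (2*h + 1) 1 - D (2*h + 1) 0 + D (2*h) 1,
                           D (2*h) 0 - D (2*h) 1] \<in> orth_C2 Y))"
proof (intro allI impI)
  fix t :: real assume t: "t > 0"
  have T: "analytic_semigroup (H_sp Y) norm_Hm1 T"
    and gen: "generator_graph (H_sp Y) norm_Hm1 T = {(x, \<lambda>s. - y s) | x y. (x, y) \<in> A_graph Y K}"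
    using assms(3) by (auto simp: analytic_semigroup_of_neg_def)
  obtain w where w0: "w 0 = u t"
    and w: "\<And>n. (w n, w (Suc n)) \<in> generator_graph (H_sp Y) norm_Hm1 T"
    using generator_graph_chain[OF T H_sp_add H_sp_cmult norm_Hm1_nonneg assms(2) t] assms(4) t
    by (metis less_imp_le)
  \<comment> \<open>First components lie in the domain of \<open>A\<close>, hence come from
    functions in \<open>V_sp Y\<close>. The generator is \<open>-A\<close>, so the second component
    enters with a minus sign.\<close>
  have "\<exists>f. f \<in> V_sp Y \<and> w n = emb f \<and>
      (\<forall>h\<in>V_sp Y. a_form K f h = inner_Hm1 (\<lambda>s. - w (Suc n) s) (emb h))" for n
    using w[of n] unfolding gen A_graph_def by force
  then obtain f where fV: "\<And>n. f n \<in> V_sp Y" and wf: "\<And>n. w n = emb (f n)"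
    and weak: "\<And>n h. h \<in> V_sp Y \<Longrightarrow> a_form K (f n) h = inner_Hm1 (\<lambda>s. - w (Suc n) s) (emb h)"
    by metis
  have f: "f n \<in> L2" for n using fV by (simp add: V_sp_def)
  have "(\<lambda>s. - w n s) = emb (\<lambda>x. - f n x)" for n
    by (auto simp: wf emb_def)
  note weak' = weak[unfolded this]
  have "\<exists>F F'. strong_solution Y K (f n) (f (Suc n)) F F'" for n
    by (rule strong_solution_exists[OF assms(1) fV f weak'])
  then obtain F F' where sol: "\<And>n. strong_solution Y K (f n) (f (Suc n)) (F n) (F' n)"
    by metis
  note sol = sol[unfolded strong_solution_def]
  have AE: "\<And>n. AE x in M01. f n x = F n x"
    and F: "\<And>n x. x \<in> {0..1} \<Longrightarrow> (F n has_vector_derivative F' n x) (at x within {0..1})"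
    and F': "\<And>n x. x \<in> {0..1} \<Longrightarrow> F' n x = F' n 0 + prim (f (Suc n)) x"
    and \<Gamma>: "\<And>n. Gamma1 (f (Suc n)) = vector [F' n 1 - F' n 0, F n 1 - F n 0 - F' n 0]"
    and bc: "\<And>n. K *v Gamma1 (f n) + vector [F' n 1 - F' n 0 + F n 1, F n 0 - F n 1] \<in> orth_C2 Y"
    using sol by blast+
  have cont: "continuous_on {0..1} (F n)" for n
    using F by (meson continuous_on_vector_derivative)
  have F2: "F n \<in> L2" for n
    by (rule L2_continuous_on[OF cont])
  \<comment> \<open>\<open>F' n\<close> is a primitive of \<open>f (Suc n)\<close>; exchanging the
    latter for the continuous \<open>F (Suc n)\<close> makes the derivative exist at every
    point.\<close>
  have F'_deriv: "(F' n has_vector_derivative F (Suc n) x) (at x within {0..1})" if "x \<in> {0..1}" for n x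
  proof (rule has_vector_derivative_transform[OF that])
    show "F' n y = F' n 0 + prim (F (Suc n)) y" if "y \<in> {0..1}" for y
      using F'[OF that] prim_cong_AE[OF L2_measurable[OF f] L2_measurable[OF F2] AE that] by simp
    show "((\<lambda>y. F' n 0 + prim (F (Suc n)) y) has_vector_derivative F (Suc n) x) (at x within {0..1})"
      using prim_has_vector_derivative[OF cont L2_integrable[OF F2] that]
      by (auto intro!: derivative_eq_intros)
  qed
  \<comment> \<open>Interleaving \<open>F\<close> and \<open>F'\<close> lists the successive
    derivatives of \<open>F 0\<close>.\<close>
  define G where "G j = (if even j then F (j div 2) else F' (j div 2))" for j
  have G_deriv: "(G j has_vector_derivative G (Suc j) x) (at x within {0..1})" if "x \<in> {0..1}" for j x
    using F[OF that] F'_deriv[OF that] by (auto simp: G_def elim!: oddE)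
  have chain: "nderiv01 j (G 0) x = G j x" if "x \<in> {0..1}" for j x
    by (rule nderiv01_chain(1)[of G, OF G_deriv that])
  show "\<exists>v. smooth01 v \<and> u t = emb v \<and>
    (\<forall>h::nat. h \<ge> 1 \<longrightarrow>
      (let D = \<lambda>j. nderiv01 j v;
           b = vector [D (2*h - 1) 1 - D (2*h - 1) 0,
                       D (2*h - 2) 1 - D (2*h - 2) 0 - D (2*h - 1) 0] :: complex ^ 2
       in b \<in> Y \<and>
          K *v b + vector [D (2*h + 1) 1 - D (2*h + 1) 0 + D (2*h) 1,
                           D (2*h) 0 - D (2*h) 1] \<in> orth_C2 Y))"
  proof (intro exI[of _ "G 0"] conjI allI impI)
    show "smooth01 (G 0)" by (rule nderiv01_chain(2)[of G, OF G_deriv])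
    show "u t = emb (G 0)"
      using emb_cong_AE[OF L2_measurable[OF f] L2_measurable[OF F2] AE, of 0] w0 wf[of 0]
      by (simp add: G_def)
    fix h :: nat assume "h \<ge> 1"
    \<comment> \<open>The moments of \<open>f h\<close> are boundary values at level
      \<open>h - 1\<close>, whereas the condition with \<open>K\<close> comes from level
      \<open>h\<close>; this is where \<open>h \<ge> 1\<close> enters.\<close>
    then obtain k where h: "h = Suc k" by (cases h) auto
    have D: "nderiv01 (2 * h - 1) (G 0) x = F' k x" "nderiv01 (2 * h - 2) (G 0) x = F k x"
      "nderiv01 (2 * h + 1) (G 0) x = F' h x" "nderiv01 (2 * h) (G 0) x = F h x"
      if "x \<in> {0..1}" for x
      using chain[OF that] by (simp_all add: G_def h)
    have "Gamma1 (f h) \<in> Y"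
      using fV by (simp add: V_sp_def)
    with \<Gamma>[of k, folded h] bc[of h]
    show "let D = \<lambda>j. nderiv01 j (G 0);
           b = vector [D (2*h - 1) 1 - D (2*h - 1) 0,
                       D (2*h - 2) 1 - D (2*h - 2) 0 - D (2*h - 1) 0] :: complex ^ 2
       in b \<in> Y \<and>
          K *v b + vector [D (2*h + 1) 1 - D (2*h + 1) 0 + D (2*h) 1,
                           D (2*h) 0 - D (2*h) 1] \<in> orth_C2 Y"
      by (simp add: Let_def D del: One_nat_def)
  qed
qed

end
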